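(* $FMC(4)=\emptyset$.
   Context: A (proper) $n$-edge-coloring of a graph $G$ is a mapping from $E(G)$ into a set of $n$ colors such that any two edges sharing a vertex receive distinct colors. A subgraph of an edge-colored graph is multicolored if no two of its edges have the same color. An edge-coloring of $G$ forbids multicolored $H$'s if each copy of $H$ in $G$ has two edges with the same color. For an integer $k\geq 2$, $FMC(2k)$ (the forbidding multicolored $2k$-cycles set) is the set of ordered pairs of integers $(m,n)$ with $k\leq m\leq n$ and $n\geq 2k$ such that there exists a (proper) $n$-edge-coloring of the complete bipartite graph $K_{m,n}$ that forbids multicolored $2k$-cycles. In particular, $FMC(4)$ consists of the pairs $(m,n)$ with $2\leq m\leq n$, $n\geq 4$, such that $K_{m,n}$ has an $n$-edge-coloring with no multicolored $4$-cycle. *)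

theory Defs
  imports "Graph_Theory.Graph_Theory"
begin

text \<open>
  As in \<^theory>\<open>Graph_Theory.Kuratowski\<close>, an undirected simple graph is a symmetric loop-free
  digraph (\<^locale>\<open>pair_graph\<close>), so an edge \<open>uv\<close> is the pair of arcs \<open>(u,v)\<close> and \<open>(v,u)\<close>.
  Edge-colorings are colorings of the unordered edges \<open>{u,v}\<close>.
\<close>

definition uedges :: "'a pair_pre_digraph \<Rightarrow> 'a set set" where
  "uedges G = (\<lambda>(u, v). {u, v}) ` parcs G"

definition proper_edge_coloring :: "nat \<Rightarrow> 'a pair_pre_digraph \<Rightarrow> ('a set \<Rightarrow> nat) \<Rightarrow> bool" where
  "proper_edge_coloring n G c \<longleftrightarrow>
     c ` uedges G \<subseteq> {..<n} \<and>
     (\<forall>e\<in>uedges G. \<forall>f\<in>uedges G. e \<noteq> f \<and> e \<inter> f \<noteq> {} \<longrightarrow> c e \<noteq> c f)"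

definition multicolored :: "('a set \<Rightarrow> nat) \<Rightarrow> 'a pair_pre_digraph \<Rightarrow> bool" where
  "multicolored c H \<longleftrightarrow> inj_on c (uedges H)"

definition is_copy_in :: "'b pair_pre_digraph \<Rightarrow> 'a pair_pre_digraph \<Rightarrow> 'a pair_pre_digraph \<Rightarrow> bool" where
  "is_copy_in H H' G \<longleftrightarrow>
     subgraph (with_proj H') (with_proj G) \<and> digraph_iso (with_proj H) (with_proj H')"

definition forbids_multicolored ::
    "'a pair_pre_digraph \<Rightarrow> ('a set \<Rightarrow> nat) \<Rightarrow> 'b pair_pre_digraph \<Rightarrow> bool" where
  "forbids_multicolored G c H \<longleftrightarrow> (\<forall>H'. is_copy_in H H' G \<longrightarrow> \<not> multicolored c H')"

text \<open>Only meaningful as the cycle of length \<open>l\<close> for \<open>l \<ge> 3\<close>.\<close>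

definition cycle_graph :: "nat \<Rightarrow> nat pair_pre_digraph" where
  "cycle_graph l = \<lparr> pverts = {..<l},
     parcs = {(i, j). i < l \<and> j < l \<and> (j = Suc i mod l \<or> i = Suc j mod l)} \<rparr>"

lemma pair_graph_cycle_graph:
  assumes "l \<ge> 3"
  shows "pair_graph (cycle_graph l)"
proof
  show "finite (parcs (cycle_graph l))"
    by (rule finite_subset[of _ "{..<l} \<times> {..<l}"]) (auto simp: cycle_graph_def)
  fix e assume "e \<in> parcs (cycle_graph l)"
  then show "fst e \<noteq> snd e"
    using assms by (auto simp: cycle_graph_def mod_Suc split: if_splits)
qed (auto simp: cycle_graph_def symmetric_def intro!: symI)

text \<open>
  \<open>FMC l\<close> is indexed by the cycle length \<open>l = 2k\<close>; it is empty by convention for odd \<open>l\<close> and for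
  \<open>l < 4\<close>. The vertices of \<open>K\<^bsub>m,n\<^esub>\<close> are named by natural numbers, and the colors are \<open>0, \<dots>, n - 1\<close>.
\<close>

definition FMC :: "nat \<Rightarrow> (nat \<times> nat) set" where
  "FMC l = {(m, n). \<exists>k\<ge>2. l = 2 * k \<and> k \<le> m \<and> m \<le> n \<and> 2 * k \<le> n \<and>
     (\<exists>(G :: nat pair_pre_digraph) c.
        K\<^bsub>m,n\<^esub> (with_proj G) \<and> proper_edge_coloring n G c \<and>
        forbids_multicolored G c (cycle_graph (2 * k)))}"

end

theory Submission
  imports Defs
begin

text \<open>
  Any proper edge-coloring of \<open>K\<^bsub>m,n\<^esub>\<close> with \<open>m \<ge> 2\<close> and \<open>n \<ge> 4\<close> contains a multicolored 4-cycle,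
  and a greedy choice finds one. Fix two vertices \<open>a\<close>, \<open>b\<close> in the part of size \<open>m\<close> and a vertex \<open>v\<close>
  in the other part. For a further vertex \<open>w\<close> of that part, adjacent edges of the 4-cycle \<open>a v b w\<close>
  have different colors automatically, so the cycle is multicolored unless one of its two pairs of
  opposite edges is monochromatic: \<open>bw\<close> has the color of \<open>av\<close>, or \<open>aw\<close> has the color of \<open>bv\<close>. The
  edges at \<open>b\<close> have distinct colors, hence the first obstruction excludes at most one \<open>w\<close>, and
  likewise the second excludes at most one, by the edges at \<open>a\<close>. So at most two of the at least
  three candidates are lost (lemma \<open>ex_avoiding_two_values\<close>).

  The remaining work is to recognize four such vertices as a copy of the 4-cycle: an injective
  homomorphism into \<open>G\<close> yields a copy of its domain (lemma \<open>is_copy_in_image\<close>).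
\<close>

lemma is_copy_in_image:
  assumes "pair_wf_digraph H" and "pair_wf_digraph G"
    and inj: "inj_on h (pverts H)"
    and verts: "h ` pverts H \<subseteq> pverts G"
    and arcs: "map_prod h h ` parcs H \<subseteq> parcs G"
  shows "is_copy_in H \<lparr> pverts = h ` pverts H, parcs = map_prod h h ` parcs H \<rparr> G"
    (is "is_copy_in H ?H' G")
proof -
  interpret H: pair_wf_digraph H by fact
  have sub: "parcs H \<subseteq> pverts H \<times> pverts H"
    by (auto dest: H.arc_fst_in_verts H.arc_snd_in_verts)
  have "pair_wf_digraph ?H'"
    using sub by unfold_locales auto
  then have "subgraph (with_proj ?H') (with_proj G)"
    using assms by (auto simp: subgraph_def compatible_def wf_digraph_wp_iff)
  moreover have "digraph_iso (with_proj H) (with_proj ?H')"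
    unfolding digraph_iso_def
  proof (intro exI conjI)
    let ?f = "\<lparr> iso_verts = h, iso_arcs = map_prod h h, iso_head = snd, iso_tail = fst \<rparr>"
    have "inj_on (map_prod h h) (parcs H)"
      by (rule inj_on_subset[OF map_prod_inj_on[OF inj inj] sub])
    then show "pre_digraph.digraph_isomorphism (with_proj H) ?f"
      using assms by (simp add: pre_digraph.digraph_isomorphism_def wf_digraph_wp_iff)
    show "with_proj ?H' = app_iso ?f (with_proj H)"
      by (simp add: app_iso_def with_proj_def)
  qed
  ultimately show ?thesis
    by (simp add: is_copy_in_def)
qed

lemma uedges_image:
  "uedges \<lparr> pverts = V, parcs = map_prod h h ` parcs H \<rparr> = (`) h ` uedges H"
  by (auto simp: uedges_def image_image intro!: image_cong)

lemma parcs_cycle_graph_4: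
  "parcs (cycle_graph 4) = {(0,1), (1,2), (2,3), (3,0), (1,0), (2,1), (3,2), (0,3)}"
proof -
  have "parcs (cycle_graph 4) =
      (\<lambda>i. (i, Suc i mod 4)) ` {..<4} \<union> (\<lambda>i. (Suc i mod 4, i)) ` {..<4}"
    by (auto simp: cycle_graph_def)
  also have "{..<4} = {0, 1, 2, 3 :: nat}"
    by auto
  finally show ?thesis
    by (simp add: insert_commute numeral_2_eq_2[symmetric])
qed

lemma pverts_cycle_graph_4: "pverts (cycle_graph 4) = {0, 1, 2, 3}"
  by (auto simp: cycle_graph_def)

lemma uedges_cycle_graph_4: "uedges (cycle_graph 4) = {{0,1}, {1,2}, {2,3}, {3,0}}"
  by (auto simp: uedges_def parcs_cycle_graph_4)

lemma multicolored_4_cycle_not_forbidden: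
  assumes G: "pair_graph G"
    and arcs: "{(a, v), (v, b), (b, w), (w, a)} \<subseteq> parcs G"
    and distinct: "distinct [a, v, b, w]"
    and colors: "distinct (map c [{a, v}, {v, b}, {b, w}, {w, a}])"
  shows "\<not> forbids_multicolored G c (cycle_graph 4)"
proof -
  interpret G: pair_graph G by (rule G)
  interpret C: pair_graph "cycle_graph 4" by (rule pair_graph_cycle_graph) simp
  define h where "h = (!) [a, v, b, w]"
  have h: "h 0 = a" "h (Suc 0) = v" "h 2 = b" "h 3 = w"
    by (simp_all add: h_def)
  let ?H = "\<lparr> pverts = h ` pverts (cycle_graph 4),
              parcs = map_prod h h ` parcs (cycle_graph 4) \<rparr>"
  have rev: "{(v, a), (b, v), (w, b), (a, w)} \<subseteq> parcs G"
    using arcs G.arcs_symmetric by auto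
  have "is_copy_in (cycle_graph 4) ?H G"
  proof (rule is_copy_in_image)
    show "inj_on h (pverts (cycle_graph 4))"
      using distinct by (auto simp: pverts_cycle_graph_4 h)
    show "h ` pverts (cycle_graph 4) \<subseteq> pverts G"
      using arcs by (auto simp: pverts_cycle_graph_4 h dest: G.arc_fst_in_verts)
    show "map_prod h h ` parcs (cycle_graph 4) \<subseteq> parcs G"
      using arcs rev by (simp add: parcs_cycle_graph_4 h)
  qed unfold_locales
  moreover have "uedges ?H = {{a, v}, {v, b}, {b, w}, {w, a}}"
    by (simp add: uedges_image uedges_cycle_graph_4 h)
  then have "multicolored c ?H"
    using colors by (auto simp: multicolored_def)
  ultimately show ?thesis
    by (auto simp: forbids_multicolored_def)
qed

text \<open>An injective function takes a forbidden value at most once.\<close>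

lemma ex_avoiding_two_values:
  assumes "inj_on f S" and "inj_on g S" and "3 \<le> card S"
  shows "\<exists>w\<in>S. f w \<noteq> p \<and> g w \<noteq> q"
proof (rule ccontr)
  have "finite S"
    using assms(3) by (simp add: card_ge_0_finite)
  assume "\<not> ?thesis"
  then have "S = {w\<in>S. f w = p} \<union> {w\<in>S. g w = q}"
    by blast
  moreover have "card {w\<in>S. f w = p} \<le> 1" and "card {w\<in>S. g w = q} \<le> 1"
    using \<open>finite S\<close> inj_onD[OF assms(1)] inj_onD[OF assms(2)]
    by (auto simp: card_le_Suc0_iff_eq)
  ultimately have "card S \<le> 2"
    by (metis card_Un_le add_mono order_trans one_add_one)
  with assms(3) show False by simp
qed

lemma proper_edge_coloringD:
  assumes "proper_edge_coloring n G c"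
    and "(x, y) \<in> parcs G" and "(x, z) \<in> parcs G" and "y \<noteq> z"
  shows "c {x, y} \<noteq> c {x, z}"
proof -
  have "{x, y} \<in> uedges G" "{x, z} \<in> uedges G"
    using assms by (auto simp: uedges_def image_iff)
  moreover have "{x, y} \<noteq> {x, z}"
    using assms by (auto simp: doubleton_eq_iff)
  moreover have "{x, y} \<inter> {x, z} \<noteq> {}"
    by blast
  ultimately show ?thesis
    using assms(1) by (auto simp: proper_edge_coloring_def)
qed

lemma complete_bipartite_not_forbids_multicolored_4_cycle:
  assumes K: "K\<^bsub>m,n\<^esub> (with_proj G)" and m: "2 \<le> m" and n: "4 \<le> n"
    and c: "proper_edge_coloring k G c"
  shows "\<not> forbids_multicolored G c (cycle_graph 4)"
proof -
  obtain U V where disj: "U \<inter> V = {}" and U: "card U = m" and V: "card V = n"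
    and arcs: "parcs G = U \<times> V \<union> V \<times> U"
    using K by (auto simp: complete_bipartite_digraph_pair_def)
  obtain a b where ab: "a \<in> U" "b \<in> U" "a \<noteq> b"
    using m U by (metis card_2_iff' obtain_subset_with_card_n subset_eq)
  obtain v where v: "v \<in> V"
    using n V by fastforce
  have proper: "c {x, y} \<noteq> c {x, z}"
    if "(x, y) \<in> parcs G" "(x, z) \<in> parcs G" "y \<noteq> z" for x y z
    using proper_edge_coloringD[OF c that] .
  have inj: "inj_on (\<lambda>w. c {x, w}) (V - {v})" if "x \<in> U" for x
    using that proper arcs by (auto simp: inj_on_def)
  have "3 \<le> card (V - {v})"
    using n V v by simp
  from ex_avoiding_two_values[OF inj[OF ab(2)] inj[OF ab(1)] this]
  obtain w where w: "w \<in> V" "w \<noteq> v" and bw: "c {b, w} \<noteq> c {a, v}" and aw: "c {a, w} \<noteq> c {b, v}"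
    by blast
  have "c {a, v} \<noteq> c {a, w}" "c {b, v} \<noteq> c {b, w}" "c {v, a} \<noteq> c {v, b}" "c {w, a} \<noteq> c {w, b}"
    using proper[of a v w] proper[of b v w] proper[of v a b] proper[of w a b] ab v w arcs
    by auto
  with bw aw have "distinct (map c [{a, v}, {v, b}, {b, w}, {w, a}])"
    by (auto simp: insert_commute)
  moreover have "{(a, v), (v, b), (b, w), (w, a)} \<subseteq> parcs G"
    using ab v w arcs by auto
  moreover have "distinct [a, v, b, w]"
    using ab v w disj by auto
  ultimately show ?thesis
    using multicolored_4_cycle_not_forbidden[OF pair_graphI_complete_bipartite[OF K]] by blast
qed

theorem proposition1:
  shows "FMC 4 = {}"
proof -
  have False if "(m, n) \<in> FMC 4" for m n
  proof -
    obtain G :: "nat pair_pre_digraph" and c where "2 \<le> m" "4 \<le> n" "K\<^bsub>m,n\<^esub> (with_proj G)"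
      "proper_edge_coloring n G c" "forbids_multicolored G c (cycle_graph 4)"
      using \<open>(m, n) \<in> FMC 4\<close> by (auto simp: FMC_def)
    then show False
      using complete_bipartite_not_forbids_multicolored_4_cycle by blast
  qed
  then show ?thesis by auto
qed

end
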